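(* Let $n_\mathrm{w},n_\mathrm{u},n_\mathrm{y}$ be positive integers and let $f_\mathrm{w}:\mathbb{R}^{n_\mathrm{w}}\times\mathbb{R}^{n_\mathrm{u}}\times\mathbb{R}^{n_\mathrm{y}}\to\mathbb{R}^{n_\mathrm{w}}$ and $g_\mathrm{w}:\mathbb{R}^{n_\mathrm{w}}\times\mathbb{R}^{n_\mathrm{u}}\to\mathbb{R}^{n_\mathrm{y}}$ be deterministic (possibly nonlinear) functions defining the system $$w_{k+1}=f_\mathrm{w}(w_k,u_k,e_k),\qquad y_k=g_\mathrm{w}(w_k,u_k)+e_k. \qquad (\mathrm{S})$$ Then there exist dimensions $n_\mathrm{x},n_\mathrm{z}\le n_\mathrm{w}$ and deterministic functions $f_\mathrm{x}:\mathbb{R}^{n_\mathrm{x}}\times\mathbb{R}^{n_\mathrm{u}}\to\mathbb{R}^{n_\mathrm{x}}$, $g_\mathrm{x}:\mathbb{R}^{n_\mathrm{x}}\times\mathbb{R}^{n_\mathrm{u}}\to\mathbb{R}^{n_\mathrm{y}}$, $f_\mathrm{z}:\mathbb{R}^{n_\mathrm{z}}\times\mathbb{R}^{n_\mathrm{x}}\times\mathbb{R}^{n_\mathrm{u}}\times\mathbb{R}^{n_\mathrm{y}}\to\mathbb{R}^{n_\mathrm{z}}$, $g_\mathrm{z}:\mathbb{R}^{n_\mathrm{z}}\times\mathbb{R}^{n_\mathrm{x}}\times\mathbb{R}^{n_\mathrm{u}}\to\mathbb{R}^{n_\mathrm{y}}$, defining the separated system $$x_{k+1}=f_\mathrm{x}(x_k,u_k),\quad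 y_{\mathrm{o},k}=g_\mathrm{x}(x_k,u_k),$$ $$z_{k+1}=f_\mathrm{z}(z_k,x_k,u_k,e_k),\quad v_k=g_\mathrm{z}(z_k,x_k,u_k)+e_k,\quad y_k=y_{\mathrm{o},k}+v_k, \qquad (\mathrm{R})$$ such that for any sample path realization $e=(e_k)_{k\ge 0}\in(\mathbb{R}^{n_\mathrm{y}})^{\mathbb{Z}_0^+}$, any $u=(u_k)_{k\ge0}\in(\mathbb{R}^{n_\mathrm{u}})^{\mathbb{Z}_0^+}$ and any initial condition $w_0\in\mathbb{R}^{n_\mathrm{w}}$, there exist $x_0\in\mathbb{R}^{n_\mathrm{x}}$ and $z_0\in\mathbb{R}^{n_\mathrm{z}}$ such that the output trajectory $(y_k)_{k\ge 0}$ of (S) started at $w_0$ and the output trajectory $(y_k)_{k\ge0}$ of (R) started at $(x_0,z_0)$, both driven by the same $u$ and $e$, are equal.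
   Context: $\mathbb{Z}_0^+$ denotes the set of non-negative integers. In (S), $w_k\in\mathbb{R}^{n_\mathrm{w}}$ is the state, $u_k\in\mathbb{R}^{n_\mathrm{u}}$ the input, $y_k\in\mathbb{R}^{n_\mathrm{y}}$ the output, and $e_k\in\mathbb{R}^{n_\mathrm{y}}$ an i.i.d. white noise process with finite variance, independent of $u$. In (R), $x_k$ is the state of the deterministic process part (denoted $G_\mathrm{o}$) with noise-free output $y_{\mathrm{o},k}$, and $z_k$ is the state of the stochastic noise part (denoted $H_\mathrm{o}$) with output $v_k$. *)

theory Defs
  imports "Jordan_Normal_Form.Matrix" "HOL-Library.FuncSet"
begin

text \<open>
  The state dimensions of the separated system are existentially quantified, so \<open>\<real>\<^sup>n\<close> is rendered as
  \<open>carrier_vec n :: real vec set\<close>.  The function arguments below are total on \<open>real vec\<close>;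
  their domains and codomains are to be imposed separately with \<open>\<rightarrow>\<close>.
\<close>

type_synonym signal = "nat \<Rightarrow> real vec"

primrec joint_state ::
  "(real vec \<Rightarrow> real vec \<Rightarrow> real vec \<Rightarrow> real vec) \<Rightarrow> signal \<Rightarrow> signal \<Rightarrow> real vec \<Rightarrow> signal" where
  "joint_state f\<^sub>w u e w\<^sub>0 0 = w\<^sub>0"
| "joint_state f\<^sub>w u e w\<^sub>0 (Suc k) = f\<^sub>w (joint_state f\<^sub>w u e w\<^sub>0 k) (u k) (e k)"

definition joint_output ::
  "(real vec \<Rightarrow> real vec \<Rightarrow> real vec \<Rightarrow> real vec) \<Rightarrow> (real vec \<Rightarrow> real vec \<Rightarrow> real vec)
    \<Rightarrow> signal \<Rightarrow> signal \<Rightarrow> real vec \<Rightarrow> signal" where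
  "joint_output f\<^sub>w g\<^sub>w u e w\<^sub>0 k = g\<^sub>w (joint_state f\<^sub>w u e w\<^sub>0 k) (u k) + e k"

primrec process_state ::
  "(real vec \<Rightarrow> real vec \<Rightarrow> real vec) \<Rightarrow> signal \<Rightarrow> real vec \<Rightarrow> signal" where
  "process_state f\<^sub>x u x\<^sub>0 0 = x\<^sub>0"
| "process_state f\<^sub>x u x\<^sub>0 (Suc k) = f\<^sub>x (process_state f\<^sub>x u x\<^sub>0 k) (u k)"

definition process_output ::
  "(real vec \<Rightarrow> real vec \<Rightarrow> real vec) \<Rightarrow> (real vec \<Rightarrow> real vec \<Rightarrow> real vec)
    \<Rightarrow> signal \<Rightarrow> real vec \<Rightarrow> signal" where
  "process_output f\<^sub>x g\<^sub>x u x\<^sub>0 k = g\<^sub>x (process_state f\<^sub>x u x\<^sub>0 k) (u k)"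

text \<open>The noise part is driven by an arbitrary process state trajectory \<open>x\<close>.\<close>

primrec noise_state ::
  "(real vec \<Rightarrow> real vec \<Rightarrow> real vec \<Rightarrow> real vec \<Rightarrow> real vec)
    \<Rightarrow> signal \<Rightarrow> signal \<Rightarrow> signal \<Rightarrow> real vec \<Rightarrow> signal" where
  "noise_state f\<^sub>z x u e z\<^sub>0 0 = z\<^sub>0"
| "noise_state f\<^sub>z x u e z\<^sub>0 (Suc k) = f\<^sub>z (noise_state f\<^sub>z x u e z\<^sub>0 k) (x k) (u k) (e k)"

definition noise_output ::
  "(real vec \<Rightarrow> real vec \<Rightarrow> real vec \<Rightarrow> real vec \<Rightarrow> real vec)
    \<Rightarrow> (real vec \<Rightarrow> real vec \<Rightarrow> real vec \<Rightarrow> real vec)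
    \<Rightarrow> signal \<Rightarrow> signal \<Rightarrow> signal \<Rightarrow> real vec \<Rightarrow> signal" where
  "noise_output f\<^sub>z g\<^sub>z x u e z\<^sub>0 k = g\<^sub>z (noise_state f\<^sub>z x u e z\<^sub>0 k) (x k) (u k) + e k"

definition separated_output ::
  "(real vec \<Rightarrow> real vec \<Rightarrow> real vec) \<Rightarrow> (real vec \<Rightarrow> real vec \<Rightarrow> real vec)
    \<Rightarrow> (real vec \<Rightarrow> real vec \<Rightarrow> real vec \<Rightarrow> real vec \<Rightarrow> real vec)
    \<Rightarrow> (real vec \<Rightarrow> real vec \<Rightarrow> real vec \<Rightarrow> real vec)
    \<Rightarrow> signal \<Rightarrow> signal \<Rightarrow> real vec \<Rightarrow> real vec \<Rightarrow> signal" where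
  "separated_output f\<^sub>x g\<^sub>x f\<^sub>z g\<^sub>z u e x\<^sub>0 z\<^sub>0 k =
     process_output f\<^sub>x g\<^sub>x u x\<^sub>0 k + noise_output f\<^sub>z g\<^sub>z (process_state f\<^sub>x u x\<^sub>0) u e z\<^sub>0 k"

end

theory Submission
  imports Defs
begin

text \<open>
  The process part \<open>x\<close> simulates the given system with the noise switched off, and the noise part
  \<open>z\<close> tracks the deviation \<open>w - x\<close> of the true state from this simulation.  The next deviation
  \<open>f\<^sub>w (w, u, e) - f\<^sub>w (x, u, 0)\<close> is a function of \<open>z\<close>, \<open>x\<close>, \<open>u\<close> and \<open>e\<close> alone because \<open>w = z + x\<close>
  recovers the true state; for the same reason the output splits into \<open>g\<^sub>w (x, u)\<close> and the increment
  \<open>g\<^sub>w (z + x, u) - g\<^sub>w (x, u)\<close>.  Hence both parts have state dimension \<open>n\<^sub>w\<close>, and the initial states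
  \<open>x\<^sub>0 = w\<^sub>0\<close>, \<open>z\<^sub>0 = 0\<close> make \<open>z\<^sub>k + x\<^sub>k = w\<^sub>k\<close> invariant for all inputs and all noise realizations
  (lemma \<open>noise_state_plus_process_state\<close>), from which equality of the outputs follows by
  cancelling \<open>g\<^sub>w (x\<^sub>k, u\<^sub>k)\<close>.
\<close>

definition noise_free :: "nat \<Rightarrow> (real vec \<Rightarrow> real vec \<Rightarrow> real vec \<Rightarrow> real vec)
    \<Rightarrow> real vec \<Rightarrow> real vec \<Rightarrow> real vec" where
  "noise_free p f x u = f x u (0\<^sub>v p)"

definition state_deviation :: "nat \<Rightarrow> (real vec \<Rightarrow> real vec \<Rightarrow> real vec \<Rightarrow> real vec)
    \<Rightarrow> real vec \<Rightarrow> real vec \<Rightarrow> real vec \<Rightarrow> real vec \<Rightarrow> real vec" where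
  "state_deviation p f z x u e = f (z + x) u e - noise_free p f x u"

definition output_deviation :: "(real vec \<Rightarrow> real vec \<Rightarrow> real vec)
    \<Rightarrow> real vec \<Rightarrow> real vec \<Rightarrow> real vec \<Rightarrow> real vec" where
  "output_deviation g z x u = g (z + x) u - g x u"

lemma noise_free_closed:
  assumes "f \<in> carrier_vec n \<rightarrow> carrier_vec m \<rightarrow> carrier_vec p \<rightarrow> carrier_vec n"
  shows "noise_free p f \<in> carrier_vec n \<rightarrow> carrier_vec m \<rightarrow> carrier_vec n"
  using assms by (simp add: noise_free_def Pi_iff)

lemma state_deviation_closed:
  assumes "f \<in> carrier_vec n \<rightarrow> carrier_vec m \<rightarrow> carrier_vec p \<rightarrow> carrier_vec n"
  shows "state_deviation p f
    \<in> carrier_vec n \<rightarrow> carrier_vec n \<rightarrow> carrier_vec m \<rightarrow> carrier_vec p \<rightarrow> carrier_vec n"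
  using assms noise_free_closed[OF assms] by (simp add: state_deviation_def Pi_iff)

lemma output_deviation_closed:
  assumes "g \<in> carrier_vec n \<rightarrow> carrier_vec m \<rightarrow> carrier_vec p"
  shows "output_deviation g \<in> carrier_vec n \<rightarrow> carrier_vec n \<rightarrow> carrier_vec m \<rightarrow> carrier_vec p"
  using assms by (simp add: output_deviation_def Pi_iff)

lemma joint_state_closed:
  assumes f: "f \<in> carrier_vec n \<rightarrow> carrier_vec m \<rightarrow> carrier_vec p \<rightarrow> carrier_vec n"
    and u: "u \<in> UNIV \<rightarrow> carrier_vec m" and e: "e \<in> UNIV \<rightarrow> carrier_vec p"
    and w\<^sub>0: "w\<^sub>0 \<in> carrier_vec n"
  shows "joint_state f u e w\<^sub>0 k \<in> carrier_vec n"
  by (induction k) (use f u e w\<^sub>0 in \<open>simp_all add: Pi_iff\<close>)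

lemma process_state_closed:
  assumes f: "f \<in> carrier_vec n \<rightarrow> carrier_vec m \<rightarrow> carrier_vec n"
    and u: "u \<in> UNIV \<rightarrow> carrier_vec m" and x\<^sub>0: "x\<^sub>0 \<in> carrier_vec n"
  shows "process_state f u x\<^sub>0 k \<in> carrier_vec n"
  by (induction k) (use f u x\<^sub>0 in \<open>simp_all add: Pi_iff\<close>)

text \<open>
  In one step the deviation becomes \<open>f (z + x) u e - f x u 0\<close> and the process state becomes
  \<open>f x u 0\<close>, so their sum telescopes to \<open>f (z + x) u e\<close>, the step of the joint system.
\<close>

lemma noise_state_plus_process_state:
  assumes f: "f \<in> carrier_vec n \<rightarrow> carrier_vec m \<rightarrow> carrier_vec p \<rightarrow> carrier_vec n"
    and u: "u \<in> UNIV \<rightarrow> carrier_vec m" and e: "e \<in> UNIV \<rightarrow> carrier_vec p"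
    and w\<^sub>0: "w\<^sub>0 \<in> carrier_vec n"
  defines "x \<equiv> process_state (noise_free p f) u w\<^sub>0"
  shows "noise_state (state_deviation p f) x u e (0\<^sub>v n) k + x k = joint_state f u e w\<^sub>0 k"
proof (induction k)
  case 0
  then show ?case using w\<^sub>0 by (simp add: x_def)
next
  case (Suc k)
  have next_process: "x (Suc k) = noise_free p f (x k) (u k)"
    by (simp add: x_def)
  have "x (Suc k) \<in> carrier_vec n"
    unfolding x_def by (rule process_state_closed[OF noise_free_closed[OF f] u w\<^sub>0])
  moreover have "joint_state f u e w\<^sub>0 (Suc k) \<in> carrier_vec n"
    by (rule joint_state_closed[OF f u e w\<^sub>0])
  moreover have "noise_state (state_deviation p f) x u e (0\<^sub>v n) (Suc k)
      = joint_state f u e w\<^sub>0 (Suc k) - x (Suc k)"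
    by (simp add: state_deviation_def Suc.IH next_process)
  moreover have "a - b + b = a" if "a \<in> carrier_vec n" "b \<in> carrier_vec n" for a b :: "real vec"
    using that by (intro eq_vecI) auto
  ultimately show ?case
    by simp
qed

lemma joint_output_eq_separated_output:
  assumes f: "f \<in> carrier_vec n \<rightarrow> carrier_vec m \<rightarrow> carrier_vec p \<rightarrow> carrier_vec n"
    and g: "g \<in> carrier_vec n \<rightarrow> carrier_vec m \<rightarrow> carrier_vec p"
    and u: "u \<in> UNIV \<rightarrow> carrier_vec m" and e: "e \<in> UNIV \<rightarrow> carrier_vec p"
    and w\<^sub>0: "w\<^sub>0 \<in> carrier_vec n"
  shows "joint_output f g u e w\<^sub>0 = separated_output (noise_free p f) g
    (state_deviation p f) (output_deviation g) u e w\<^sub>0 (0\<^sub>v n)"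
proof
  fix k
  define x where "x = process_state (noise_free p f) u w\<^sub>0 k"
  define w where "w = joint_state f u e w\<^sub>0 k"
  have x: "x \<in> carrier_vec n"
    unfolding x_def by (rule process_state_closed[OF noise_free_closed[OF f] u w\<^sub>0])
  have w: "w \<in> carrier_vec n"
    unfolding w_def by (rule joint_state_closed[OF f u e w\<^sub>0])
  have gx: "g x (u k) \<in> carrier_vec p" and gw: "g w (u k) \<in> carrier_vec p"
    and ek: "e k \<in> carrier_vec p"
    using g u e x w by (simp_all add: Pi_iff)
  have "separated_output (noise_free p f) g (state_deviation p f) (output_deviation g) u e w\<^sub>0
      (0\<^sub>v n) k = g x (u k) + (g w (u k) - g x (u k) + e k)"
    by (simp add: separated_output_def process_output_def noise_output_def output_deviation_def
        noise_state_plus_process_state[OF f u e w\<^sub>0] x_def w_def)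
  also have "\<dots> = g w (u k) + e k"
    using gx gw ek by auto
  finally show "joint_output f g u e w\<^sub>0 k = separated_output (noise_free p f) g
      (state_deviation p f) (output_deviation g) u e w\<^sub>0 (0\<^sub>v n) k"
    by (simp add: joint_output_def w_def)
qed

theorem theorem1:
  fixes n\<^sub>w n\<^sub>u n\<^sub>y :: nat
    and f\<^sub>w :: "real vec \<Rightarrow> real vec \<Rightarrow> real vec \<Rightarrow> real vec"
    and g\<^sub>w :: "real vec \<Rightarrow> real vec \<Rightarrow> real vec"
  assumes "0 < n\<^sub>w" and "0 < n\<^sub>u" and "0 < n\<^sub>y"
    and "f\<^sub>w \<in> carrier_vec n\<^sub>w \<rightarrow> carrier_vec n\<^sub>u \<rightarrow> carrier_vec n\<^sub>y \<rightarrow> carrier_vec n\<^sub>w"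
    and "g\<^sub>w \<in> carrier_vec n\<^sub>w \<rightarrow> carrier_vec n\<^sub>u \<rightarrow> carrier_vec n\<^sub>y"
  shows "\<exists>n\<^sub>x n\<^sub>z. 0 < n\<^sub>x \<and> n\<^sub>x \<le> n\<^sub>w \<and> 0 < n\<^sub>z \<and> n\<^sub>z \<le> n\<^sub>w \<and>
    (\<exists>f\<^sub>x \<in> carrier_vec n\<^sub>x \<rightarrow> carrier_vec n\<^sub>u \<rightarrow> carrier_vec n\<^sub>x.
     \<exists>g\<^sub>x \<in> carrier_vec n\<^sub>x \<rightarrow> carrier_vec n\<^sub>u \<rightarrow> carrier_vec n\<^sub>y.
     \<exists>f\<^sub>z \<in> carrier_vec n\<^sub>z \<rightarrow> carrier_vec n\<^sub>x \<rightarrow> carrier_vec n\<^sub>u \<rightarrow> carrier_vec n\<^sub>y \<rightarrow> carrier_vec n\<^sub>z.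
     \<exists>g\<^sub>z \<in> carrier_vec n\<^sub>z \<rightarrow> carrier_vec n\<^sub>x \<rightarrow> carrier_vec n\<^sub>u \<rightarrow> carrier_vec n\<^sub>y.
       \<forall>e \<in> UNIV \<rightarrow> carrier_vec n\<^sub>y. \<forall>u \<in> UNIV \<rightarrow> carrier_vec n\<^sub>u. \<forall>w\<^sub>0 \<in> carrier_vec n\<^sub>w.
         \<exists>x\<^sub>0 \<in> carrier_vec n\<^sub>x. \<exists>z\<^sub>0 \<in> carrier_vec n\<^sub>z.
           joint_output f\<^sub>w g\<^sub>w u e w\<^sub>0 = separated_output f\<^sub>x g\<^sub>x f\<^sub>z g\<^sub>z u e x\<^sub>0 z\<^sub>0)"
proof (intro exI conjI)
  show "0 < n\<^sub>w" "n\<^sub>w \<le> n\<^sub>w" "0 < n\<^sub>w" "n\<^sub>w \<le> n\<^sub>w"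
    using assms(1) by simp_all
  note f = assms(4) and g = assms(5)
  show "\<exists>f\<^sub>x \<in> carrier_vec n\<^sub>w \<rightarrow> carrier_vec n\<^sub>u \<rightarrow> carrier_vec n\<^sub>w.
     \<exists>g\<^sub>x \<in> carrier_vec n\<^sub>w \<rightarrow> carrier_vec n\<^sub>u \<rightarrow> carrier_vec n\<^sub>y.
     \<exists>f\<^sub>z \<in> carrier_vec n\<^sub>w \<rightarrow> carrier_vec n\<^sub>w \<rightarrow> carrier_vec n\<^sub>u \<rightarrow> carrier_vec n\<^sub>y \<rightarrow> carrier_vec n\<^sub>w.
     \<exists>g\<^sub>z \<in> carrier_vec n\<^sub>w \<rightarrow> carrier_vec n\<^sub>w \<rightarrow> carrier_vec n\<^sub>u \<rightarrow> carrier_vec n\<^sub>y.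
       \<forall>e \<in> UNIV \<rightarrow> carrier_vec n\<^sub>y. \<forall>u \<in> UNIV \<rightarrow> carrier_vec n\<^sub>u. \<forall>w\<^sub>0 \<in> carrier_vec n\<^sub>w.
         \<exists>x\<^sub>0 \<in> carrier_vec n\<^sub>w. \<exists>z\<^sub>0 \<in> carrier_vec n\<^sub>w.
           joint_output f\<^sub>w g\<^sub>w u e w\<^sub>0 = separated_output f\<^sub>x g\<^sub>x f\<^sub>z g\<^sub>z u e x\<^sub>0 z\<^sub>0"
    by (rule bexI[OF _ noise_free_closed[OF f]], rule bexI[OF _ g],
        rule bexI[OF _ state_deviation_closed[OF f]], rule bexI[OF _ output_deviation_closed[OF g]])
      (blast intro: joint_output_eq_separated_output[OF f g] zero_carrier_vec)
qed

end
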